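(* For every positive integer $n$ that is a perfect square, there exists a set $\mathcal P$ of $n$ points in $\mathbb R^2$ such that no two points of $\mathcal P$ have the same $x$-coordinate and $D(\mathcal P)=2\sqrt{n}-2$ under the $\ell_\infty$ metric.
   Context: Under the $\ell_\infty$ metric, the distance between $(a_x,a_y)$ and $(b_x,b_y)$ is $\max\{|a_x-b_x|,|a_y-b_y|\}$. For a finite set $\mathcal P\subset\mathbb R^2$, $D(\mathcal P)$ denotes the number of distinct distances spanned by pairs of distinct points of $\mathcal P$. *)

theory Defs
  imports "HOL-Analysis.Analysis"
begin

definition linf_dist :: "real \<times> real \<Rightarrow> real \<times> real \<Rightarrow> real" where
  "linf_dist a b = max \<bar>fst a - fst b\<bar> \<bar>snd a - snd b\<bar>"

lemma linf_dist_eq_infnorm: "linf_dist a b = infnorm (a - b)"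
proof -
  have basis: "(Basis :: (real \<times> real) set) = {(1, 0), (0, 1)}"
    by (auto simp: Basis_prod_def)
  have "{\<bar>(a - b) \<bullet> i\<bar> |i. i \<in> Basis} = {\<bar>fst a - fst b\<bar>, \<bar>snd a - snd b\<bar>}"
    unfolding Setcompr_eq_image basis by (simp add: inner_prod_def)
  then show ?thesis
    by (simp add: infnorm_def linf_dist_def cSup_insert sup_real_def)
qed

text \<open>Meaningful for finite point sets only: \<^const>\<open>card\<close> of an infinite set is 0.\<close>

definition distinct_distances :: "(real \<times> real) set \<Rightarrow> nat" where
  "distinct_distances P = card {linf_dist p q | p q. p \<in> P \<and> q \<in> P \<and> p \<noteq> q}"

end

theory Submission
  imports Defs
begin

text \<open>
  For \<open>n = m\<^sup>2\<close> place \<open>m\<close> equally spaced points on each of \<open>m\<close> horizontal lines, the lines being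
  shifted slightly against each other so that no two points share an \<open>x\<close>-coordinate. The lines are
  as far apart as the whole configuration is wide: two points on the same line are at one of \<open>m - 1\<close>
  horizontal distances, and two points on different lines are at one of \<open>m - 1\<close> larger vertical
  distances.
\<close>

text \<open>A single index below m^2 encodes the point: it is the \<open>x\<close>-coordinate
  itself, so these never repeat, and its residue mod \<open>m\<close> selects the line. A line thus
  has spacing \<open>m\<close> and is shifted by its residue. The line spacing m^2 exceeds the total
  width m^2 - 1.\<close>

definition sheared_grid_point :: "nat \<Rightarrow> nat \<Rightarrow> real \<times> real" where
  "sheared_grid_point m k = (real k, real (m\<^sup>2 * (k mod m)))"

lemma inj_sheared_grid_point: "inj (sheared_grid_point m)"
  by (auto simp: inj_def sheared_grid_point_def)

lemma linf_dist_commute: "linf_dist a b = linf_dist b a"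
  by (simp add: linf_dist_def abs_minus_commute)

lemma linf_dist_sheared_grid_same_row:
  assumes "k mod m = l mod m"
  shows "linf_dist (sheared_grid_point m k) (sheared_grid_point m l) = \<bar>real k - real l\<bar>"
  using assms by (simp add: linf_dist_def sheared_grid_point_def)

text \<open>The horizontal gap is below m^2 and the vertical gap is at least m^2, so the vertical
  one attains the maximum. With \<open>k\<close> on the higher line, the natural subtraction is not
  truncated.\<close>

lemma linf_dist_sheared_grid_different_row:
  assumes "k < m\<^sup>2" "l < m\<^sup>2" "l mod m < k mod m"
  shows "linf_dist (sheared_grid_point m k) (sheared_grid_point m l)
           = real (m\<^sup>2 * (k mod m - l mod m))"
proof -
  have "\<bar>real k - real l\<bar> \<le> real (m\<^sup>2)"
    using assms by linarith
  also have "real (m\<^sup>2) \<le> real (m\<^sup>2 * (k mod m - l mod m))"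
  proof -
    have "1 \<le> k mod m - l mod m"
      using assms(3) by linarith
    then show ?thesis
      by (simp only: of_nat_le_iff) simp
  qed
  finally have width: "\<bar>real k - real l\<bar> \<le> real (m\<^sup>2 * (k mod m - l mod m))" .
  have "real (m\<^sup>2 * (k mod m)) - real (m\<^sup>2 * (l mod m)) = real (m\<^sup>2 * (k mod m - l mod m))"
    using assms(3) by (simp add: of_nat_diff right_diff_distrib)
  with width show ?thesis
    by (simp add: linf_dist_def sheared_grid_point_def max_def)
qed

text \<open>Indices with equal residue differ by a multiple of \<open>m\<close>, which gives the
  first family; differences of residues give the second. Stating both as an image under
  \<open>real\<close> lets the counting take place in the naturals.\<close>

lemma sheared_grid_distances:
  "{linf_dist p q | p q. p \<in> sheared_grid_point m ` {..<m\<^sup>2} \<and>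
      q \<in> sheared_grid_point m ` {..<m\<^sup>2} \<and> p \<noteq> q}
   = real ` ((\<lambda>t. m * t) ` {1..<m} \<union> (\<lambda>t. m\<^sup>2 * t) ` {1..<m})"
  (is "?L = real ` ?R")
proof (intro equalityI subsetI)
  \<comment> \<open>Order the two points lexicographically by residue and then index; the opposite
    order follows from symmetry of the distance.\<close>
  have wlog: "linf_dist (sheared_grid_point m k) (sheared_grid_point m l) \<in> real ` ?R"
    if kl: "k < m\<^sup>2" "l < m\<^sup>2" and "l mod m < k mod m \<or> l mod m = k mod m \<and> l < k" for k l
    using that(3)
  proof
    assume less: "l mod m < k mod m"
    have "m > 0" using kl by (cases m) auto
    then have "k mod m < m" by simp
    with less have "1 \<le> k mod m - l mod m" "k mod m - l mod m < m"
      by linarith+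
    then have "k mod m - l mod m \<in> {1..<m}"
      unfolding atLeastLessThan_iff by (rule conjI)
    then show ?thesis
      using linf_dist_sheared_grid_different_row[OF kl less] by blast
  next
    assume same: "l mod m = k mod m \<and> l < k"
    then obtain t where t: "k - l = m * t"
      by (metis dvdE mod_eq_dvd_iff_nat less_imp_le)
    have "m * t < m * m"
      using t kl unfolding power2_eq_square by linarith
    moreover have "t \<noteq> 0"
      using t same by (intro notI) simp
    ultimately have "t \<in> {1..<m}"
      by simp
    moreover have "linf_dist (sheared_grid_point m k) (sheared_grid_point m l) = real (m * t)"
      using linf_dist_sheared_grid_same_row[of k m l] same
      by (simp flip: t add: of_nat_diff)
    ultimately show ?thesis by blast
  qed
  fix d assume "d \<in> ?L"
  then obtain k l where kl: "k < m\<^sup>2" "l < m\<^sup>2" "k \<noteq> l"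
    and d: "d = linf_dist (sheared_grid_point m k) (sheared_grid_point m l)"
    by blast
  consider "l mod m < k mod m \<or> l mod m = k mod m \<and> l < k"
    | "k mod m < l mod m \<or> k mod m = l mod m \<and> k < l"
    using \<open>k \<noteq> l\<close> by linarith
  then show "d \<in> real ` ?R"
    using wlog kl d linf_dist_commute by cases metis+
next
  \<comment> \<open>All distances already occur from the point of index 0: index
    \<open>m * t\<close> stays on its line, while index \<open>t < m\<close> lies on line
    \<open>t\<close>.\<close>
  have witness: "linf_dist (sheared_grid_point m k) (sheared_grid_point m 0) \<in> ?L"
    if "k < m\<^sup>2" "k > 0" for k
  proof -
    have "sheared_grid_point m k \<noteq> sheared_grid_point m 0"
      using that inj_sheared_grid_point by (metis injD less_irrefl)
    moreover have "0 < m\<^sup>2"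
      using that by linarith
    ultimately show ?thesis
      using that by blast
  qed
  fix d assume "d \<in> real ` ?R"
  then consider t where "t \<in> {1..<m}" "d = real (m * t)"
    | t where "t \<in> {1..<m}" "d = real (m\<^sup>2 * t)"
    by blast
  then show "d \<in> ?L"
  proof cases
    case 1
    then have "m * t < m\<^sup>2" "m * t > 0"
      by (auto simp: power2_eq_square)
    with witness[of "m * t"] show ?thesis
      using 1 linf_dist_sheared_grid_same_row[of "m * t" m 0] by simp
  next
    case 2
    then have t: "t < m\<^sup>2" "t > 0" "t mod m = t"
      by (auto simp: power2_eq_square intro: less_le_trans[of t m "m * m"])
    then have "linf_dist (sheared_grid_point m t) (sheared_grid_point m 0) = d"
      using 2 linf_dist_sheared_grid_different_row[of t m 0] by simp
    with witness[of t] t show ?thesis by simp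
  qed
qed

lemma distinct_distances_sheared_grid:
  "distinct_distances (sheared_grid_point m ` {..<m\<^sup>2}) = 2 * (m - 1)"
proof -
  have disjoint: "(\<lambda>t. m * t) ` {1..<m} \<inter> (\<lambda>t. m\<^sup>2 * t) ` {1..<m} = {}"
  proof -
    \<comment> \<open>The largest distance within a line, m(m - 1), is still below the smallest one
      between lines, m^2.\<close>
    have "m * s < m\<^sup>2 * t" if "s \<in> {1..<m}" "t \<in> {1..<m}" for s t
    proof -
      have "m * s < m * m"
        using that by simp
      also have "m * m \<le> m\<^sup>2 * t"
        using that by (simp add: power2_eq_square)
      finally show ?thesis .
    qed
    then show ?thesis by fastforce
  qed
  have inj: "inj_on (\<lambda>t. m * t) {1..<m}" "inj_on (\<lambda>t. m\<^sup>2 * t) {1..<m}"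
    by (auto simp: inj_on_def)
  have "distinct_distances (sheared_grid_point m ` {..<m\<^sup>2})
      = card ((\<lambda>t. m * t) ` {1..<m} \<union> (\<lambda>t. m\<^sup>2 * t) ` {1..<m})"
    unfolding distinct_distances_def sheared_grid_distances by (rule card_image) simp
  also have "\<dots> = card ((\<lambda>t. m * t) ` {1..<m}) + card ((\<lambda>t. m\<^sup>2 * t) ` {1..<m})"
    using disjoint by (intro card_Un_disjoint) auto
  also have "\<dots> = 2 * (m - 1)"
    using inj by (simp add: card_image)
  finally show ?thesis .
qed

theorem theorem1p4:
  fixes n :: nat
  assumes "n > 0" and "\<exists>m::nat. n = m ^ 2"
  shows "\<exists>P :: (real \<times> real) set.
           finite P \<and> card P = n \<and>
           (\<forall>p\<in>P. \<forall>q\<in>P. p \<noteq> q \<longrightarrow> fst p \<noteq> fst q) \<and>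
           real (distinct_distances P) = 2 * sqrt (real n) - 2"
proof -
  obtain m where n: "n = m\<^sup>2"
    using assms(2) by blast
  with \<open>n > 0\<close> have "m > 0" by (cases m) auto
  let ?P = "sheared_grid_point m ` {..<m\<^sup>2}"
  have "card ?P = n"
    using n by (simp add: card_image inj_on_subset[OF inj_sheared_grid_point])
  moreover have "\<forall>p\<in>?P. \<forall>q\<in>?P. p \<noteq> q \<longrightarrow> fst p \<noteq> fst q"
    by (auto simp: sheared_grid_point_def)
  moreover have "real (distinct_distances ?P) = 2 * sqrt (real n) - 2"
    \<comment> \<open>Positivity of \<open>m\<close> turns the truncated \<open>m - 1\<close> into a
      real difference.\<close>
    using n \<open>m > 0\<close> by (simp add: distinct_distances_sheared_grid of_nat_diff)
  ultimately show ?thesis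
    by (intro exI[of _ ?P]) simp
qed

end
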